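(* Let $\alpha\approx 0.278$ be the real solution of the equation $\alpha e^{1+\alpha}=1$. Let $n$ be a positive integer and let $Z=(z_{ij})$ be an $n\times n$ complex matrix such that $$\sum_{j=1}^n\left|1-z_{ij}\right|\le\frac{\alpha n}{4}\quad\text{for }i=1,\dots,n$$ and $$\sum_{i=1}^n\left|1-z_{ij}\right|\le\frac{\alpha n}{4}\quad\text{for }j=1,\dots,n.$$ Then $\operatorname{per}Z\ne 0$.
   Context: The permanent of an $n\times n$ matrix $Z=(z_{ij})$ is $\operatorname{per}Z=\sum_{\sigma\in S_n}\prod_{i=1}^n z_{i\sigma(i)}$, where $S_n$ is the symmetric group of permutations of $\{1,\dots,n\}$. *)

theory Defs
  imports Complex_Main "Jordan_Normal_Form.Determinant"
begin

text \<open>Rows and columns are indexed by \<open>0, ..., n - 1\<close>, as for \<^const>\<open>det\<close>; as there, the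
  value on non-square matrices is the dummy \<open>0\<close>.\<close>

definition permanent :: "'a :: comm_ring_1 mat \<Rightarrow> 'a" where
  "permanent A = (if dim_row A = dim_col A
     then (\<Sum>\<sigma> \<in> {\<sigma>. \<sigma> permutes {0..<dim_row A}}. \<Prod>i = 0..<dim_row A. A $$ (i, \<sigma> i))
     else 0)"

text \<open>The equation below determines \<open>\<alpha>\<close>, so it can be used as a hypothesis on a real \<open>\<alpha>\<close>.\<close>

lemma ex1_alpha: "\<exists>!\<alpha>::real. \<alpha> * exp (1 + \<alpha>) = 1"
proof -
  have "\<exists>x::real. 0 \<le> x \<and> x \<le> 1 \<and> x * exp (1 + x) = 1"
    by (rule IVT') (auto intro!: continuous_intros)
  moreover have "x = y" if xy: "x * exp (1 + x) = 1" "y * exp (1 + y) = 1" for x y :: real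
  proof -
    have pos: "0 < z" if "z * exp (1 + z) = 1" for z :: real
      using zero_less_mult_pos2[of z "exp (1 + z)"] that by simp
    have lt: "a * exp (1 + a) < b * exp (1 + b)" if "0 < a" "a < b" for a b :: real
      using that by (intro mult_strict_mono) auto
    show ?thesis
      using lt[of x y] lt[of y x] pos xy by (metis less_irrefl linorder_neqE_linordered_idom)
  qed
  ultimately show ?thesis by blast
qed

end

theory Submission
  imports Defs "HOL-Computational_Algebra.Fundamental_Theorem_Algebra"
begin

text \<open>
  Write \<open>Z\<close> as the all-ones matrix plus \<open>A\<close>. Expanding the products in the permanent groups the
  terms by the partial matchings \<open>M\<close> of rows to columns, and \<open>M\<close> extends to \<open>(n - |M|)!\<close>
  permutations. Hence \<open>per Z\<close> is the image of the matching polynomial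
  \<open>\<mu>(t) = \<Sum>\<^sub>M a(M) t^(n - |M|)\<close>, where \<open>a(M)\<close> is the product of the entries of \<open>A\<close> on \<open>M\<close>,
  under the linear functional \<open>t^k \<mapsto> k!\<close>
  (lemma \<open>sum_permutes_prod_eq_fact_coeff\<close>). Three facts about zeros then combine.

  First, a matching sum with complex weights cannot vanish if the absolute values of the weights sum
  to at most \<open>1/4\<close> in every row and column: deleting a row or column at most
  doubles the absolute value of the sum, and this bound reproduces itself because
  \<open>1 - 2 \<cdot> 1/4 = 1/2\<close>. After rescaling, all zeros of \<open>\<mu>\<close> lie in the open disc of radius \<open>\<alpha>n\<close> (lemma \<open>matching_poly_root_bound\<close>).

  Second, the functional \<open>t^k \<mapsto> k!\<close> on polynomials of degree at most \<open>n\<close> is, up to a nonzero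
  constant, the apolar pairing with \<open>\<Sum>\<^sub>k (-z)^k / k!\<close>, summed over \<open>k \<le> n\<close>, and Grace's theorem
  says that the pairing of two polynomials of degree \<open>n\<close> is nonzero when a disc contains all
  zeros of one and no zero of the other (theorem \<open>grace_disc\<close>).

  Third, the truncated exponential \<open>\<Sum>\<^sub>k z^k / k!\<close>, \<open>k \<le> n\<close>, has no zero with \<open>|z| < \<alpha>n\<close>
  (lemma \<open>truncated_exp_root_bound\<close>). This is where the equation for \<open>\<alpha>\<close> comes from: the zeros,
  divided by \<open>n\<close>, accumulate on the Szegoe curve \<open>|z exp(1 - z)| = 1\<close>, \<open>|z| \<le> 1\<close>, whose point closest
  to the origin is \<open>-\<alpha>\<close>.
\<close>

section \<open>Matching sums\<close>

definition matchings :: "'a set \<Rightarrow> 'b set \<Rightarrow> ('a \<times> 'b) set set" where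
  "matchings R C = {M. M \<subseteq> R \<times> C \<and> inj_on fst M \<and> inj_on snd M}"

definition matching_sum :: "('a \<times> 'b \<Rightarrow> complex) \<Rightarrow> 'a set \<Rightarrow> 'b set \<Rightarrow> complex" where
  "matching_sum x R C = (\<Sum>M\<in>matchings R C. \<Prod>e\<in>M. x e)"

lemma finite_matchings: "finite R \<Longrightarrow> finite C \<Longrightarrow> finite (matchings R C)"
  by (rule finite_subset[of _ "Pow (R \<times> C)"]) (auto simp: matchings_def)

lemma finite_matching: "finite R \<Longrightarrow> finite C \<Longrightarrow> M \<in> matchings R C \<Longrightarrow> finite M"
  by (rule finite_subset[of _ "R \<times> C"]) (auto simp: matchings_def)

lemma matchings_empty [simp]: "matchings {} C = {{}}" "matchings R {} = {{}}"
  by (auto simp: matchings_def)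

lemma matching_sum_empty [simp]: "matching_sum x {} C = 1" "matching_sum x R {} = 1"
  by (simp_all add: matching_sum_def)

text \<open>A matching either avoids the row \<open>i\<close>, or it is a matching of the remaining rows into the columns
  other than \<open>j\<close>, together with the edge \<open>(i, j)\<close>.\<close>

lemma matchings_insert_row:
  assumes "i \<notin> R"
  shows "matchings (insert i R) C =
    matchings R C \<union> (\<Union>j\<in>C. insert (i, j) ` matchings R (C - {j}))" (is "?L = ?A \<union> ?B")
proof (intro equalityI subsetI)
  fix M assume M: "M \<in> ?L"
  show "M \<in> ?A \<union> ?B"
  proof (cases "\<exists>j. (i, j) \<in> M")
    case False
    with M show ?thesis by (auto simp: matchings_def)
  next
    case True
    then obtain j where j: "(i, j) \<in> M" by blast
    have MRC: "M \<subseteq> insert i R \<times> C" and inj: "inj_on fst M" "inj_on snd M"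
      using M by (auto simp: matchings_def)
    have "M - {(i, j)} \<subseteq> R \<times> (C - {j})"
    proof
      fix e assume e: "e \<in> M - {(i, j)}"
      have "fst e \<noteq> i" "snd e \<noteq> j"
        using inj_onD[OF inj(1), of e "(i, j)"] inj_onD[OF inj(2), of e "(i, j)"] e j by auto
      with MRC e show "e \<in> R \<times> (C - {j})" by (auto simp: mem_Times_iff)
    qed
    then have "M - {(i, j)} \<in> matchings R (C - {j})"
      using inj by (simp add: matchings_def inj_on_diff)
    moreover have "M = insert (i, j) (M - {(i, j)})" using j by blast
    moreover have "j \<in> C" using MRC j by blast
    ultimately show ?thesis by blast
  qed
next
  fix M assume "M \<in> ?A \<union> ?B"
  then show "M \<in> ?L"
  proof
    assume "M \<in> ?A"
    then show ?thesis by (auto simp: matchings_def)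
  next
    assume "M \<in> ?B"
    then obtain j N where N: "j \<in> C" "M = insert (i, j) N" "N \<in> matchings R (C - {j})" by auto
    have sub: "N \<subseteq> R \<times> (C - {j})" and inj: "inj_on fst N" "inj_on snd N"
      using N(3) by (auto simp: matchings_def)
    have "i \<notin> fst ` N" "j \<notin> snd ` N"
      using sub assms by auto
    then have "inj_on fst M" "inj_on snd M"
      using inj by (simp_all add: N(2) image_iff)
    moreover have "M \<subseteq> insert i R \<times> C" using sub N(1,2) by blast
    ultimately show ?thesis by (simp add: matchings_def)
  qed
qed

lemma matching_sum_insert_row:
  assumes fin: "finite R" "finite C" and i: "i \<notin> R"
  shows "matching_sum x (insert i R) C =
    matching_sum x R C + (\<Sum>j\<in>C. x (i, j) * matching_sum x R (C - {j}))"
proof -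
  have notin: "(i, j) \<notin> N" if "N \<in> matchings R D" for j :: 'b and N D
    using that i by (auto simp: matchings_def)
  have inj: "inj_on (insert (i, j)) (matchings R (C - {j}))" for j
    by (rule inj_onI) (metis insert_ident notin)
  have "matching_sum x (insert i R) C = matching_sum x R C +
      (\<Sum>M\<in>(\<Union>j\<in>C. insert (i, j) ` matchings R (C - {j})). \<Prod>e\<in>M. x e)"
    unfolding matching_sum_def matchings_insert_row[OF i]
  proof (rule sum.union_disjoint)
    show "matchings R C \<inter> (\<Union>j\<in>C. insert (i, j) ` matchings R (C - {j})) = {}"
      using notin by blast
  qed (use fin in \<open>auto intro!: finite_matchings\<close>)
  also have "(\<Sum>M\<in>(\<Union>j\<in>C. insert (i, j) ` matchings R (C - {j})). \<Prod>e\<in>M. x e) =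
      (\<Sum>j\<in>C. \<Sum>M\<in>insert (i, j) ` matchings R (C - {j}). \<Prod>e\<in>M. x e)"
  proof (rule sum.UNION_disjoint)
    show "\<forall>j\<in>C. \<forall>k\<in>C. j \<noteq> k \<longrightarrow>
        insert (i, j) ` matchings R (C - {j}) \<inter> insert (i, k) ` matchings R (C - {k}) = {}"
    proof (intro ballI impI equals0I)
      fix j k M assume "j \<noteq> k"
        and "M \<in> insert (i, j) ` matchings R (C - {j}) \<inter> insert (i, k) ` matchings R (C - {k})"
      then obtain N where "(i, j) \<in> insert (i, k) N" "N \<in> matchings R (C - {k})" by blast
      with \<open>j \<noteq> k\<close> notin show False by blast
    qed
  qed (use fin in \<open>auto intro!: finite_matchings\<close>)
  also have "\<dots> = (\<Sum>j\<in>C. x (i, j) * matching_sum x R (C - {j}))"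
  proof (rule sum.cong[OF refl])
    fix j assume "j \<in> C"
    have "(\<Sum>M\<in>insert (i, j) ` matchings R (C - {j}). \<Prod>e\<in>M. x e) =
        (\<Sum>N\<in>matchings R (C - {j}). \<Prod>e\<in>insert (i, j) N. x e)"
      by (simp add: sum.reindex[OF inj])
    also have "\<dots> = (\<Sum>N\<in>matchings R (C - {j}). x (i, j) * (\<Prod>e\<in>N. x e))"
      by (intro sum.cong refl prod.insert notin) (use fin in \<open>auto intro: finite_matching\<close>)
    finally show "(\<Sum>M\<in>insert (i, j) ` matchings R (C - {j}). \<Prod>e\<in>M. x e) =
        x (i, j) * matching_sum x R (C - {j})"
      by (simp add: matching_sum_def sum_distrib_left)
  qed
  finally show ?thesis .
qed

text \<open>Transposition carries each statement about rows over to columns.\<close>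

lemma matching_sum_swap: "matching_sum x R C = matching_sum (x \<circ> prod.swap) C R"
proof -
  have swap: "image prod.swap ` matchings R C \<subseteq> matchings C R"
    for R :: "'c set" and C :: "'d set"
  proof -
    have "fst \<circ> prod.swap = (snd :: 'c \<times> 'd \<Rightarrow> 'd)" "snd \<circ> prod.swap = (fst :: 'c \<times> 'd \<Rightarrow> 'c)"
      by auto
    then show ?thesis
      by (auto simp: matchings_def intro!: inj_on_imageI)
  qed
  have bij: "bij_betw (image prod.swap) (matchings C R) (matchings R C)"
    by (rule bij_betw_byWitness[where f' = "image prod.swap"])
      (use swap[of R C] swap[of C R] in \<open>auto simp: image_comp\<close>)
  have "matching_sum x R C = (\<Sum>M\<in>matchings C R. \<Prod>e\<in>prod.swap ` M. x e)"
    unfolding matching_sum_def by (rule sum.reindex_bij_betw[OF bij, symmetric])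
  then show ?thesis
    by (simp add: matching_sum_def prod.reindex)
qed

lemma matching_sum_insert_col:
  assumes "finite R" "finite C" "j \<notin> C"
  shows "matching_sum x R (insert j C) =
    matching_sum x R C + (\<Sum>i\<in>R. x (i, j) * matching_sum x (R - {i}) C)"
  unfolding matching_sum_swap[of x] using assms by (subst matching_sum_insert_row) auto

text \<open>The step that makes the induction below close up: if every \<open>c k\<close> is at most twice as large as \<open>m\<close>,
  weights of total size \<open>1/4\<close> perturb \<open>m\<close> by at most half of its size.\<close>

lemma norm_half_le_add_small_sum:
  fixes m :: complex and c :: "'a \<Rightarrow> complex"
  assumes "(\<Sum>k\<in>K. cmod (w k)) \<le> 1 / 4" and "\<And>k. k \<in> K \<Longrightarrow> cmod (c k) \<le> 2 * cmod m"
  shows "cmod m \<le> 2 * cmod (m + (\<Sum>k\<in>K. w k * c k))"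
proof -
  have "cmod (\<Sum>k\<in>K. w k * c k) \<le> (\<Sum>k\<in>K. cmod (w k) * (2 * cmod m))"
    by (rule sum_norm_le) (auto simp: norm_mult intro!: mult_left_mono assms(2))
  also have "\<dots> \<le> 1 / 4 * (2 * cmod m)"
    unfolding sum_distrib_right[symmetric] by (rule mult_right_mono[OF assms(1)]) simp
  finally show ?thesis
    using norm_diff_ineq[of m "\<Sum>k\<in>K. w k * c k"] by simp
qed

text \<open>Expanding along row \<open>i\<close> writes the matching sum as that of \<open>(R - {i}, C)\<close> plus a weighted sum
  over those of \<open>(R - {i}, C - {j})\<close>, which the induction hypothesis for deleting the column \<open>j\<close>
  from \<open>(R - {i}, C)\<close> controls. Rows and columns therefore have to be treated in one induction.\<close>

lemma matching_sum_delete_le: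
  fixes x :: "'a \<times> 'b \<Rightarrow> complex"
  assumes fin: "finite R" "finite C"
    and row: "\<And>i. i \<in> R \<Longrightarrow> (\<Sum>j\<in>C. cmod (x (i, j))) \<le> 1 / 4"
    and col: "\<And>j. j \<in> C \<Longrightarrow> (\<Sum>i\<in>R. cmod (x (i, j))) \<le> 1 / 4"
  shows "(\<forall>i\<in>R. cmod (matching_sum x (R - {i}) C) \<le> 2 * cmod (matching_sum x R C)) \<and>
    (\<forall>j\<in>C. cmod (matching_sum x R (C - {j})) \<le> 2 * cmod (matching_sum x R C))"
  using assms
proof (induction "card R + card C" arbitrary: R C rule: less_induct)
  case less
  note fin = \<open>finite R\<close> \<open>finite C\<close>
  have IH: "(\<forall>i\<in>R'. cmod (matching_sum x (R' - {i}) C') \<le> 2 * cmod (matching_sum x R' C')) \<and>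
      (\<forall>j\<in>C'. cmod (matching_sum x R' (C' - {j})) \<le> 2 * cmod (matching_sum x R' C'))"
    if "R' \<subseteq> R" "C' \<subseteq> C" "card R' + card C' < card R + card C" for R' C'
  proof (rule less.hyps[OF that(3)])
    show "finite R'" "finite C'" using that fin by (auto intro: finite_subset)
    show "(\<Sum>j\<in>C'. cmod (x (i, j))) \<le> 1 / 4" if "i \<in> R'" for i
      by (rule order.trans[OF sum_mono2 less.prems(3)]) (use fin that \<open>R' \<subseteq> R\<close> \<open>C' \<subseteq> C\<close> in auto)
    show "(\<Sum>i\<in>R'. cmod (x (i, j))) \<le> 1 / 4" if "j \<in> C'" for j
      by (rule order.trans[OF sum_mono2 less.prems(4)]) (use fin that \<open>R' \<subseteq> R\<close> \<open>C' \<subseteq> C\<close> in auto)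
  qed
  show ?case
  proof (intro conjI ballI)
    fix i assume i: "i \<in> R"
    have "card (R - {i}) < card R" using i fin by (intro card_Diff1_less)
    then have "cmod (matching_sum x (R - {i}) (C - {j})) \<le> 2 * cmod (matching_sum x (R - {i}) C)"
      if "j \<in> C" for j using IH[of "R - {i}" C] that by auto
    from norm_half_le_add_small_sum[OF less.prems(3)[OF i] this]
    show "cmod (matching_sum x (R - {i}) C) \<le> 2 * cmod (matching_sum x R C)"
      using matching_sum_insert_row[of "R - {i}" C i x] fin i by (simp add: insert_absorb)
  next
    fix j assume j: "j \<in> C"
    have "card (C - {j}) < card C" using j fin by (intro card_Diff1_less)
    then have "cmod (matching_sum x (R - {i}) (C - {j})) \<le> 2 * cmod (matching_sum x R (C - {j}))"
      if "i \<in> R" for i using IH[of R "C - {j}"] that by auto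
    from norm_half_le_add_small_sum[OF less.prems(4)[OF j] this]
    show "cmod (matching_sum x R (C - {j})) \<le> 2 * cmod (matching_sum x R C)"
      using matching_sum_insert_col[of R "C - {j}" j x] fin j by (simp add: insert_absorb)
  qed
qed

text \<open>Deleting the rows one at a time leads to the empty matching sum \<open>1\<close>, and no deletion can turn \<open>0\<close>
  into a nonzero value.\<close>

lemma matching_sum_nonzero:
  assumes "finite R" "finite C"
    and "\<And>i. i \<in> R \<Longrightarrow> (\<Sum>j\<in>C. cmod (x (i, j))) \<le> 1 / 4"
    and "\<And>j. j \<in> C \<Longrightarrow> (\<Sum>i\<in>R. cmod (x (i, j))) \<le> 1 / 4"
  shows "matching_sum x R C \<noteq> 0"
  using assms
proof (induction R rule: finite_induct)
  case (insert i R)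
  have "(\<Sum>i\<in>R. cmod (x (i, j))) \<le> 1 / 4" if "j \<in> C" for j
    by (rule order.trans[OF sum_mono2 insert.prems(3)[OF that]]) (use insert.hyps in auto)
  then have "matching_sum x R C \<noteq> 0"
    using insert by auto
  moreover have "cmod (matching_sum x (insert i R - {i}) C) \<le> 2 * cmod (matching_sum x (insert i R) C)"
    using matching_sum_delete_le[OF _ insert.prems] insert.hyps by blast
  ultimately show ?case
    using insert.hyps by auto
qed simp

section \<open>Permanents as factorially weighted matching sums\<close>

lemma permutes_extending_bij:
  assumes "finite S" "bij_betw g D E" "D \<subseteq> S" "E \<subseteq> S"
  obtains \<tau> where "\<tau> permutes S" "\<And>i. i \<in> D \<Longrightarrow> \<tau> i = g i"
proof -
  have "card (S - D) = card (S - E)"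
    using assms bij_betw_same_card[OF assms(2)] by (simp add: card_Diff_subset finite_subset)
  then obtain h where h: "bij_betw h (S - D) (S - E)"
    using assms(1) finite_same_card_bij by blast
  define \<tau> where "\<tau> i = (if i \<in> D then g i else if i \<in> S then h i else i)" for i
  have "bij_betw \<tau> D E"
    using assms(2) by (subst bij_betw_cong[of _ _ g]) (auto simp: \<tau>_def)
  moreover have "bij_betw \<tau> (S - D) (S - E)"
    using h by (subst bij_betw_cong[of _ _ h]) (auto simp: \<tau>_def)
  ultimately have "bij_betw \<tau> (D \<union> (S - D)) (E \<union> (S - E))"
    by (rule bij_betw_combine) blast
  then have "bij_betw \<tau> S S"
    using assms by (simp add: Un_absorb1)
  then have "\<tau> permutes S"
    by (rule bij_imp_permutes) (use assms in \<open>auto simp: \<tau>_def\<close>)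
  then show thesis
    by (rule that) (simp add: \<tau>_def)
qed

text \<open>Composing with one fixed permutation \<open>\<tau>\<close> that extends the matching turns the extensions of the
  matching into the permutations of the unmatched rows.\<close>

lemma card_permutes_containing_matching:
  assumes S: "finite S" and M: "M \<in> matchings S S"
  shows "card {\<sigma>. \<sigma> permutes S \<and> M \<subseteq> (\<lambda>i. (i, \<sigma> i)) ` S} = fact (card S - card M)"
proof -
  have inj: "inj_on fst M" "inj_on snd M" and sub: "fst ` M \<subseteq> S" "snd ` M \<subseteq> S"
    using M by (auto simp: matchings_def)
  have "bij_betw (snd \<circ> inv_into M fst) (fst ` M) (snd ` M)"
    using inj by (intro bij_betw_trans[OF bij_betw_inv_into]) (auto simp: bij_betw_def)
  then obtain \<tau> where \<tau>: "\<tau> permutes S" "\<And>i. i \<in> fst ` M \<Longrightarrow> \<tau> i = snd (inv_into M fst i)"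
    using permutes_extending_bij[OF S _ sub] by (metis comp_apply)
  have \<tau>M: "\<tau> (fst e) = snd e" if "e \<in> M" for e
    using \<tau>(2)[of "fst e"] that inj by simp
  have "{\<sigma>. \<sigma> permutes S \<and> M \<subseteq> (\<lambda>i. (i, \<sigma> i)) ` S} =
      (\<lambda>\<pi>. \<tau> \<circ> \<pi>) ` {\<pi>. \<pi> permutes (S - fst ` M)}" (is "?L = ?R")
  proof (intro equalityI subsetI)
    fix \<sigma> assume "\<sigma> \<in> ?L"
    then have \<sigma>: "\<sigma> permutes S" "\<And>e. e \<in> M \<Longrightarrow> \<sigma> (fst e) = snd e" by auto
    have perm: "inv_into UNIV \<tau> \<circ> \<sigma> permutes S"
      using \<sigma> \<tau> by (intro permutes_compose permutes_inv)
    have fixed: "(inv_into UNIV \<tau> \<circ> \<sigma>) i = i" if "i \<in> fst ` M" for i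
    proof -
      obtain e where "e \<in> M" "i = fst e" using \<open>i \<in> fst ` M\<close> by blast
      then show ?thesis using \<sigma>(2) \<tau>M permutes_inverses(2)[OF \<tau>(1)] by (metis comp_apply)
    qed
    have "inv_into UNIV \<tau> \<circ> \<sigma> permutes (S - fst ` M)"
      by (rule permutes_superset[OF perm]) (use fixed in auto)
    moreover have "\<sigma> = \<tau> \<circ> (inv_into UNIV \<tau> \<circ> \<sigma>)"
      using permutes_inv_o(1)[OF \<tau>(1)] by (simp add: comp_assoc[symmetric])
    ultimately show "\<sigma> \<in> ?R" by blast
  next
    fix \<sigma> assume "\<sigma> \<in> ?R"
    then obtain \<pi> where \<pi>: "\<pi> permutes (S - fst ` M)" "\<sigma> = \<tau> \<circ> \<pi>" by blast
    have "\<sigma> permutes S"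
      unfolding \<pi>(2) by (rule permutes_compose[OF permutes_subset[OF \<pi>(1)] \<tau>(1)]) blast
    moreover have "e \<in> (\<lambda>i. (i, \<sigma> i)) ` S" if "e \<in> M" for e
    proof (rule image_eqI[of _ _ "fst e"])
      have "\<pi> (fst e) = fst e"
        using \<pi>(1) that by (auto intro: permutes_not_in)
      then show "e = (fst e, \<sigma> (fst e))"
        using \<tau>M[OF that] \<pi>(2) by (simp add: prod_eq_iff)
    qed (use sub that in auto)
    ultimately show "\<sigma> \<in> ?L" by blast
  qed
  moreover have "inj_on (\<lambda>\<pi>. \<tau> \<circ> \<pi>) {\<pi>. \<pi> permutes (S - fst ` M)}"
    using permutes_inj[OF \<tau>(1)] by (auto intro!: inj_onI simp: fun.inj_map_strong fun_eq_iff inj_eq)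
  ultimately have "card {\<sigma>. \<sigma> permutes S \<and> M \<subseteq> (\<lambda>i. (i, \<sigma> i)) ` S} =
      card {\<pi>. \<pi> permutes (S - fst ` M)}"
    by (simp add: card_image)
  also have "\<dots> = fact (card (S - fst ` M))"
    using S by (intro card_permutations) auto
  also have "card (S - fst ` M) = card S - card M"
    using sub S inj by (simp add: card_Diff_subset finite_subset card_image)
  finally show ?thesis .
qed

text \<open>Each subset of the graph of a permutation is a matching; exchanging the sum over permutations with
  the sum over the subsets of their graphs leaves the extensions of each matching to be counted.\<close>

lemma sum_permutes_prod_one_plus:
  fixes a :: "'a \<times> 'a \<Rightarrow> complex"
  assumes S: "finite S"
  shows "(\<Sum>\<sigma> | \<sigma> permutes S. \<Prod>i\<in>S. 1 + a (i, \<sigma> i)) =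
    (\<Sum>M\<in>matchings S S. fact (card S - card M) * (\<Prod>e\<in>M. a e))"
proof -
  let ?G = "\<lambda>\<sigma>. (\<lambda>i. (i, \<sigma> i)) ` S"
  have expand: "(\<Prod>i\<in>S. 1 + a (i, \<sigma> i)) = (\<Sum>M | M \<in> matchings S S \<and> M \<subseteq> ?G \<sigma>. \<Prod>e\<in>M. a e)"
    if \<sigma>: "\<sigma> permutes S" for \<sigma>
  proof -
    have "(\<Prod>i\<in>S. 1 + a (i, \<sigma> i)) = (\<Prod>e\<in>?G \<sigma>. a e + 1)"
      by (subst prod.reindex) (auto simp: inj_on_def add.commute)
    also have "\<dots> = (\<Sum>M\<in>Pow (?G \<sigma>). \<Prod>e\<in>M. a e)"
      by (subst prod_add) (use S in auto)
    also have "Pow (?G \<sigma>) = {M. M \<in> matchings S S \<and> M \<subseteq> ?G \<sigma>}"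
    proof -
      have "inj_on fst (?G \<sigma>)" "inj_on snd (?G \<sigma>)" "?G \<sigma> \<subseteq> S \<times> S"
        using permutes_inj[OF \<sigma>] permutes_in_image[OF \<sigma>] by (auto simp: inj_on_def inj_def)
      then have "M \<in> matchings S S" if "M \<subseteq> ?G \<sigma>" for M
        using that unfolding matchings_def by (blast intro: inj_on_subset)
      then show ?thesis by auto
    qed
    finally show ?thesis .
  qed
  have "(\<Sum>\<sigma> | \<sigma> permutes S. \<Prod>i\<in>S. 1 + a (i, \<sigma> i)) =
      (\<Sum>\<sigma> | \<sigma> permutes S. \<Sum>M | M \<in> matchings S S \<and> M \<subseteq> ?G \<sigma>. \<Prod>e\<in>M. a e)"
    by (intro sum.cong refl expand) simp
  also have "\<dots> = (\<Sum>M\<in>matchings S S. \<Sum>\<sigma> | \<sigma> \<in> {\<sigma>. \<sigma> permutes S} \<and> M \<subseteq> ?G \<sigma>. \<Prod>e\<in>M. a e)"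
    by (rule sum.swap_restrict) (use S in \<open>auto intro: finite_permutations finite_matchings\<close>)
  also have "\<dots> = (\<Sum>M\<in>matchings S S. fact (card S - card M) * (\<Prod>e\<in>M. a e))"
    by (intro sum.cong refl) (simp add: card_permutes_containing_matching[OF S])
  finally show ?thesis .
qed

section \<open>Grace's apolarity theorem for a disc\<close>

text \<open>The apolar pairing of two binary forms of degree \<open>d\<close>, in dehomogenised coordinates. The degree
  is a parameter because \<open>f\<close> and \<open>g\<close> may have smaller degree as polynomials.\<close>

definition apolar :: "nat \<Rightarrow> complex poly \<Rightarrow> complex poly \<Rightarrow> complex" where
  "apolar d f g = (\<Sum>k\<le>d. (- 1) ^ k * poly.coeff f k * poly.coeff g (d - k) / of_nat (d choose k))"

text \<open>Laguerre's derivative of \<open>f\<close> with respect to the pole \<open>\<zeta>\<close>, for \<open>f\<close> regarded as a form of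
  degree \<open>d\<close>; \<open>pderiv f\<close> corresponds to the pole at infinity.\<close>

definition polar_deriv :: "nat \<Rightarrow> complex \<Rightarrow> complex poly \<Rightarrow> complex poly" where
  "polar_deriv d \<zeta> f = smult (of_nat d) f + [:\<zeta>, - 1:] * pderiv f"

lemma poly_polar_deriv:
  "poly (polar_deriv d \<zeta> f) z = of_nat d * poly f z + (\<zeta> - z) * poly (pderiv f) z"
  by (simp add: polar_deriv_def algebra_simps)

lemma coeff_polar_deriv:
  "poly.coeff (polar_deriv d \<zeta> f) k =
    (of_nat d - of_nat k) * poly.coeff f k + \<zeta> * of_nat (Suc k) * poly.coeff f (Suc k)"
  by (cases k) (simp_all add: polar_deriv_def coeff_pderiv algebra_simps)

text \<open>Multiplication by \<open>z - \<zeta>\<close> and the polar derivative at \<open>\<zeta>\<close> are adjoint to each other for the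
  apolar pairing, so the zeros of \<open>g\<close> can be removed one at a time at the expense of polar
  derivatives of \<open>f\<close>.\<close>

lemma apolar_mult_linear:
  assumes "degree g \<le> d"
  shows "of_nat (Suc d) * apolar (Suc d) f ([:- \<zeta>, 1:] * g) = apolar d (polar_deriv (Suc d) \<zeta> f) g"
proof -
  let ?t = "\<lambda>k. (- 1) ^ k * poly.coeff f k / of_nat (Suc d choose k) :: complex"
  let ?g = "poly.coeff g"
  have g: "?g (Suc d) = 0" using assms by (simp add: coeff_eq_0)
  have c: "poly.coeff ([:- \<zeta>, 1:] * g) (Suc d - k) =
      (if k \<le> d then ?g (d - k) else 0) - \<zeta> * ?g (Suc d - k)" if "k \<le> Suc d" for k
    using that by (auto simp: Suc_diff_le le_Suc_eq)
  have "apolar (Suc d) f ([:- \<zeta>, 1:] * g) =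
      (\<Sum>k\<le>Suc d. ?t k * ((if k \<le> d then ?g (d - k) else 0) - \<zeta> * ?g (Suc d - k)))"
    unfolding apolar_def by (intro sum.cong refl) (simp only: c atMost_iff times_divide_eq_left mult.assoc)
  also have "\<dots> = (\<Sum>k\<le>Suc d. ?t k * (if k \<le> d then ?g (d - k) else 0)) -
      (\<Sum>k\<le>Suc d. ?t k * (\<zeta> * ?g (Suc d - k)))"
    by (simp only: right_diff_distrib sum_subtractf)
  also have "(\<Sum>k\<le>Suc d. ?t k * (if k \<le> d then ?g (d - k) else 0)) = (\<Sum>k\<le>d. ?t k * ?g (d - k))"
    by simp
  also have "(\<Sum>k\<le>Suc d. ?t k * (\<zeta> * ?g (Suc d - k))) = (\<Sum>k\<le>d. ?t (Suc k) * (\<zeta> * ?g (d - k)))"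
    by (subst sum.atMost_Suc_shift) (simp add: g)
  finally have "of_nat (Suc d) * apolar (Suc d) f ([:- \<zeta>, 1:] * g) =
      (\<Sum>k\<le>d. of_nat (Suc d) * (?t k - \<zeta> * ?t (Suc k)) * ?g (d - k))"
    by (simp only: sum_subtractf[symmetric] sum_distrib_left) (simp add: algebra_simps)
  also have "\<dots> = apolar d (polar_deriv (Suc d) \<zeta> f) g"
    unfolding apolar_def
  proof (intro sum.cong refl)
    fix k assume "k \<in> {..d}"
    then have k: "k \<le> d" by simp
    let ?b = "of_nat (d choose k) :: complex"
    have nz: "?b \<noteq> 0" "of_nat (Suc d choose k) \<noteq> (0::complex)" "of_nat (Suc d choose Suc k) \<noteq> (0::complex)"
      using k by (simp_all del: binomial_Suc_Suc)
    have 1: "of_nat (Suc d) * ?b = (of_nat (Suc d) - of_nat k) * of_nat (Suc d choose k)"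
      using binomial_absorb_comp[of "Suc d" k] k
      by (simp only: of_nat_diff[symmetric] of_nat_mult[symmetric] le_SucI) simp
    have 2: "of_nat (Suc d) * ?b = of_nat (Suc k) * of_nat (Suc d choose Suc k)"
      using Suc_times_binomial[of k d] by (simp only: of_nat_mult[symmetric])
    have "of_nat (Suc d) / of_nat (Suc d choose k) = (of_nat (Suc d) - of_nat k) / ?b"
      using nz 1 by (simp add: frac_eq_eq)
    moreover have "of_nat (Suc d) / of_nat (Suc d choose Suc k) = of_nat (Suc k) / ?b"
      using nz 2 by (simp add: frac_eq_eq)
    moreover have "of_nat (Suc d) * (?t k - \<zeta> * ?t (Suc k)) =
        (- 1) ^ k * (poly.coeff f k * (of_nat (Suc d) / of_nat (Suc d choose k)) +
          \<zeta> * poly.coeff f (Suc k) * (of_nat (Suc d) / of_nat (Suc d choose Suc k)))"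
      by (simp add: field_simps del: binomial_Suc_Suc of_nat_Suc)
    ultimately have "of_nat (Suc d) * (?t k - \<zeta> * ?t (Suc k)) =
        (- 1) ^ k * poly.coeff (polar_deriv (Suc d) \<zeta> f) k / ?b"
      by (simp only: coeff_polar_deriv) (simp add: algebra_simps add_divide_distrib diff_divide_distrib del: binomial_Suc_Suc of_nat_Suc)
    then show "of_nat (Suc d) * (?t k - \<zeta> * ?t (Suc k)) * ?g (d - k) =
        (- 1) ^ k * poly.coeff (polar_deriv (Suc d) \<zeta> f) k * ?g (d - k) / ?b"
      by simp
  qed
  finally show ?thesis .
qed

lemma complex_poly_split:
  fixes f :: "complex poly"
  assumes "f \<noteq> 0"
  obtains c t where "c \<noteq> 0" "f = smult c (\<Prod>i<degree f. [:- t i, 1:])"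
proof -
  obtain A where A: "size A = degree f" "f = smult (lead_coeff f) (\<Prod>x\<in>#A. [:-x, 1:])"
    using alg_closed_imp_factorization[OF assms] by blast
  obtain xs where xs: "mset xs = A" using ex_mset by blast
  have "(\<Prod>x\<in>#A. [:-x, 1:]) = (\<Prod>x\<leftarrow>xs. [:-x, 1:])"
    by (simp add: xs[symmetric] flip: prod_mset_prod_list)
  also have "\<dots> = (\<Prod>i<degree f. [:- (xs ! i), 1:])"
    using A(1) xs by (simp add: prod.list_conv_set_nth atLeast0LessThan flip: size_mset)
  finally have "f = smult (lead_coeff f) (\<Prod>i<degree f. [:- (xs ! i), 1:])"
    using A(2) by simp
  then show thesis
    using assms by (intro that[of "lead_coeff f" "\<lambda>i. xs ! i"]) simp_all
qed

lemma coeff_prod_linear_top: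
  fixes t :: "nat \<Rightarrow> complex"
  shows "poly.coeff (\<Prod>i<d. [:- t i, 1:]) d = 1"
proof -
  have "degree (\<Prod>i<d. [:- t i, 1:]) = d"
    by (simp add: degree_prod_eq_sum_degree)
  moreover have "lead_coeff (\<Prod>i<d. [:- t i, 1:]) = 1"
    by (simp only: lead_coeff_prod) simp
  ultimately show ?thesis by metis
qed

lemma coeff_prod_linear_second:
  fixes t :: "nat \<Rightarrow> complex"
  shows "poly.coeff (\<Prod>i<Suc d. [:- t i, 1:]) d = - (\<Sum>i<Suc d. t i)"
proof (induction d)
  case (Suc d)
  let ?P = "\<Prod>i<Suc d. [:- t i, 1:]"
  have "poly.coeff ?P (Suc d) = 1" by (rule coeff_prod_linear_top)
  then have "poly.coeff (?P * [:- t (Suc d), 1:]) (Suc d) = - (\<Sum>i<Suc d. t i) - t (Suc d)"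
    using Suc by (simp add: mult.commute[of ?P] del: prod.lessThan_Suc sum.lessThan_Suc)
  then show ?case by (simp add: mult.commute)
qed simp

lemma log_deriv_prod_linear:
  fixes t :: "nat \<Rightarrow> complex"
  assumes "\<And>i. i < d \<Longrightarrow> z \<noteq> t i"
  shows "poly (pderiv (\<Prod>i<d. [:- t i, 1:])) z =
    poly (\<Prod>i<d. [:- t i, 1:]) z * (\<Sum>i<d. 1 / (z - t i))"
  using assms
proof (induction d)
  case (Suc d)
  let ?P = "\<Prod>i<d. [:- t i, 1:]" and ?S = "\<Sum>i<d. 1 / (z - t i)"
  have "poly (pderiv ?P) z = poly ?P z * ?S" and "z \<noteq> t d" using Suc by auto
  moreover have "poly (pderiv (?P * [:- t d, 1:])) z = poly ?P z + (z - t d) * poly (pderiv ?P) z"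
    by (simp only: pderiv_mult) (simp add: pderiv_pCons algebra_simps)
  moreover have "poly (?P * [:- t d, 1:]) z = poly ?P z * (z - t d)"
    by (simp only: poly_mult) simp
  ultimately show ?case
    by (simp only: prod.lessThan_Suc sum.lessThan_Suc) (simp add: field_simps)
qed simp

text \<open>The point \<open>\<zeta>\<close> is the centre of mass of the \<open>t i\<close> as seen from \<open>z\<close>: the map \<open>s \<mapsto> 1 / (z - s)\<close>
  sends it to the mean of the images. As \<open>z\<close> lies outside the disc, the image of the disc is convex
  (a disc or a half-plane), so the mean stays in the image.\<close>

lemma centre_of_roots_in_disc:
  fixes t :: "nat \<Rightarrow> complex"
  assumes t: "\<And>i. i < d \<Longrightarrow> cmod (t i) < \<rho>" and d: "d > 0"
    and z: "cmod z \<ge> \<rho>" and mean: "of_nat d / (z - \<zeta>) = (\<Sum>i<d. 1 / (z - t i))" and "z \<noteq> \<zeta>"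
  shows "cmod \<zeta> < \<rho>"
proof -
  define K where "K = (cmod z)\<^sup>2 - \<rho>\<^sup>2"
  have \<rho>: "\<rho> > 0" using t[OF d] norm_ge_zero[of "t 0"] by linarith
  have K: "K \<ge> 0" using z \<rho> unfolding K_def by (simp add: power_mono)
  \<comment> \<open>The image of the disc is a sublevel set of a quadratic function of \<open>w\<close>, convex as \<open>K \<ge> 0\<close>.\<close>
  have disc: "cmod s < \<rho> \<longleftrightarrow> K * (cmod w)\<^sup>2 - 2 * Re (z * w) + 1 < 0"
    if "s \<noteq> z" "w = 1 / (z - s)" for s w
  proof -
    have w: "w \<noteq> 0" and s: "s * w = z * w - 1" using that by (auto simp: field_simps)
    have "cmod s < \<rho> \<longleftrightarrow> cmod (s * w) < \<rho> * cmod w"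
      using w by (simp add: norm_mult)
    also have "\<dots> \<longleftrightarrow> (cmod (z * w - 1))\<^sup>2 < (\<rho> * cmod w)\<^sup>2"
      unfolding s using \<rho> power2_less_imp_less[of "cmod (z * w - 1)" "\<rho> * cmod w"]
        power_strict_mono[of "cmod (z * w - 1)" "\<rho> * cmod w" 2] by auto
    also have "(cmod (z * w - 1))\<^sup>2 = (cmod z)\<^sup>2 * (cmod w)\<^sup>2 - 2 * Re (z * w) + 1"
      unfolding cmod_power2 by (simp add: power2_eq_square algebra_simps)
    finally show ?thesis
      by (simp add: K_def power_mult_distrib algebra_simps)
  qed
  define w where "w i = 1 / (z - t i)" for i
  define w0 where "w0 = 1 / (z - \<zeta>)"
  \<comment> \<open>\<open>l\<close> is the tangent of this quadratic function at \<open>w0\<close>: a lower bound that commutes with means.\<close>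
  define a where "a = 2 * (of_real K * cnj w0 - z)"
  define l where "l v = Re (a * v) + (1 - K * (cmod w0)\<^sup>2)" for v
  have l_eq: "l v = K * (2 * Re (cnj w0 * v) - (cmod w0)\<^sup>2) - 2 * Re (z * v) + 1" for v
    by (simp add: l_def a_def algebra_simps)
  have l: "l v \<le> K * (cmod v)\<^sup>2 - 2 * Re (z * v) + 1" for v
  proof -
    have "0 \<le> (cmod (v - w0))\<^sup>2" by simp
    also have "\<dots> = (cmod v)\<^sup>2 - (2 * Re (cnj w0 * v) - (cmod w0)\<^sup>2)"
      unfolding cmod_power2 by (simp add: power2_eq_square algebra_simps)
    finally show ?thesis unfolding l_eq using K by (simp add: mult_left_mono)
  qed
  have "l (w i) < 0" if "i < d" for i
  proof -
    have "t i \<noteq> z" using t[OF that] z by auto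
    with disc[of "t i" "w i"] t[OF that] l[of "w i"] show ?thesis by (simp add: w_def)
  qed
  then have "(\<Sum>i<d. l (w i)) < (\<Sum>i<d. 0)"
    using d by (intro sum_strict_mono) auto
  moreover have "(\<Sum>i<d. l (w i)) = real d * l w0"
  proof -
    have W: "(\<Sum>i<d. w i) = of_nat d * w0" using mean by (simp add: w_def w0_def)
    have "(\<Sum>i<d. l (w i)) = Re (a * (\<Sum>i<d. w i)) + real d * (1 - K * (cmod w0)\<^sup>2)"
      by (simp only: l_def sum.distrib sum_distrib_left Re_sum) simp
    also have "\<dots> = real d * l w0"
      unfolding W l_def by (simp add: algebra_simps)
    finally show ?thesis .
  qed
  ultimately have "l w0 < 0" using d by (simp add: mult_less_0_iff)
  moreover have "Re (cnj w0 * w0) = (cmod w0)\<^sup>2"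
    unfolding cmod_power2 by (simp add: power2_eq_square)
  ultimately show ?thesis
    using disc[of \<zeta> w0] \<open>z \<noteq> \<zeta>\<close> by (simp add: l_eq w0_def)
qed

text \<open>At a zero \<open>z\<close> of the polar derivative, the logarithmic derivative of \<open>f\<close> equals
  \<open>(d + 1) / (z - \<zeta>)\<close>, so \<open>\<zeta>\<close> is the centre of mass of the zeros of \<open>f\<close> as seen from \<open>z\<close>; it would lie
  in the disc if \<open>z\<close> did not. The degree drops by exactly one because the leading coefficient vanishes
  only if \<open>\<zeta>\<close> is the ordinary mean of the zeros of \<open>f\<close>.\<close>

lemma laguerre_disc:
  assumes deg: "degree f = Suc d" and roots: "\<And>z. poly f z = 0 \<Longrightarrow> cmod z < \<rho>"
    and \<zeta>: "cmod \<zeta> \<ge> \<rho>"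
  shows "degree (polar_deriv (Suc d) \<zeta> f) = d"
    and "poly (polar_deriv (Suc d) \<zeta> f) z = 0 \<Longrightarrow> cmod z < \<rho>"
proof -
  have "f \<noteq> 0" using deg by auto
  then obtain c t where c: "c \<noteq> 0" and f: "f = smult c (\<Prod>i<Suc d. [:- t i, 1:])"
    using complex_poly_split[of f] deg by metis
  have t: "cmod (t i) < \<rho>" if "i < Suc d" for i
    by (rule roots) (use that c in \<open>auto simp: f poly_prod prod_zero_iff simp del: prod.lessThan_Suc intro!: bexI[of _ i]\<close>)
  have "poly.coeff f (Suc d) = c"
    unfolding f coeff_smult coeff_prod_linear_top by simp
  moreover have "poly.coeff f d = - c * (\<Sum>i<Suc d. t i)"
    unfolding f coeff_smult coeff_prod_linear_second by (simp del: sum.lessThan_Suc)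
  ultimately have "poly.coeff (polar_deriv (Suc d) \<zeta> f) d = c * (of_nat (Suc d) * \<zeta> - (\<Sum>i<Suc d. t i))"
    unfolding coeff_polar_deriv by (simp add: algebra_simps del: sum.lessThan_Suc)
  moreover have "cmod (\<Sum>i<Suc d. t i) < cmod (of_nat (Suc d) * \<zeta>)"
  proof -
    have "cmod (\<Sum>i<Suc d. t i) \<le> (\<Sum>i<Suc d. cmod (t i))" by (rule norm_sum)
    also have "\<dots> < (\<Sum>i<Suc d. \<rho>)" by (rule sum_strict_mono) (use t in auto)
    also have "\<dots> \<le> cmod (of_nat (Suc d) * \<zeta>)"
      using \<zeta> by (simp add: norm_mult mult_left_mono del: of_nat_Suc)
    finally show ?thesis .
  qed
  ultimately have "poly.coeff (polar_deriv (Suc d) \<zeta> f) d \<noteq> 0" using c by auto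
  moreover have "degree (polar_deriv (Suc d) \<zeta> f) \<le> d"
  proof (rule degree_le, intro allI impI)
    fix k assume "k > d"
    then show "poly.coeff (polar_deriv (Suc d) \<zeta> f) k = 0"
      using deg by (cases "k = Suc d") (simp_all add: coeff_polar_deriv coeff_eq_0)
  qed
  ultimately show "degree (polar_deriv (Suc d) \<zeta> f) = d"
    by (intro antisym le_degree)
  show "cmod z < \<rho>" if z0: "poly (polar_deriv (Suc d) \<zeta> f) z = 0"
  proof (rule ccontr)
    assume "\<not> cmod z < \<rho>"
    then have z: "cmod z \<ge> \<rho>" by simp
    then have fz: "poly f z \<noteq> 0" using roots by fastforce
    have zt: "z \<noteq> t i" if "i < Suc d" for i using t[OF that] z by auto
    have "poly (pderiv f) z = poly f z * (\<Sum>i<Suc d. 1 / (z - t i))"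
      unfolding f pderiv_smult poly_smult using log_deriv_prod_linear[of "Suc d" z t] zt by simp
    with z0 have "poly f z * (of_nat (Suc d) + (\<zeta> - z) * (\<Sum>i<Suc d. 1 / (z - t i))) = 0"
      by (simp add: poly_polar_deriv algebra_simps del: sum.lessThan_Suc of_nat_Suc)
    with fz have "of_nat (Suc d) + (\<zeta> - z) * (\<Sum>i<Suc d. 1 / (z - t i)) = 0"
      unfolding mult_eq_0_iff by blast
    then have eq: "of_nat (Suc d) = (z - \<zeta>) * (\<Sum>i<Suc d. 1 / (z - t i))"
      by (simp add: algebra_simps add_eq_0_iff del: sum.lessThan_Suc of_nat_Suc)
    then have "z \<noteq> \<zeta>" using of_nat_eq_0_iff[of "Suc d", where 'a = complex] by auto
    with eq have "of_nat (Suc d) / (z - \<zeta>) = (\<Sum>i<Suc d. 1 / (z - t i))"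
      by (simp add: field_simps del: sum.lessThan_Suc of_nat_Suc)
    from centre_of_roots_in_disc[OF t _ z this \<open>z \<noteq> \<zeta>\<close>] \<zeta> show False by simp
  qed
qed

text \<open>Grace's theorem, by induction on the degree: a zero of \<open>g\<close> is split off and moved to the other side
  of the pairing as a polar derivative, which keeps the zeros of \<open>f\<close> in the disc.\<close>

theorem grace_disc:
  assumes "degree f = d" and "\<And>z. poly f z = 0 \<Longrightarrow> cmod z < \<rho>"
    and "degree g = d" and "\<And>z. poly g z = 0 \<Longrightarrow> cmod z \<ge> \<rho>"
    and "f \<noteq> 0" "g \<noteq> 0"
  shows "apolar d f g \<noteq> 0"
  using assms
proof (induction d arbitrary: f g)
  case 0
  then show ?case
    by (auto simp: apolar_def elim!: degree_eq_zeroE)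
next
  case (Suc d)
  obtain \<zeta> where \<zeta>: "poly g \<zeta> = 0"
    using Suc.prems(3) fundamental_theorem_of_algebra[of g] by (auto simp: constant_degree)
  then obtain g1 where g1: "g = [:- \<zeta>, 1:] * g1"
    by (auto simp: poly_eq_0_iff_dvd)
  have "g1 \<noteq> 0" using g1 Suc.prems(6) by auto
  then have dg1: "degree g1 = d"
    using Suc.prems(3) unfolding g1 by (subst (asm) degree_mult_eq) auto
  have "cmod \<zeta> \<ge> \<rho>" using \<zeta> Suc.prems(4) by simp
  note L = laguerre_disc[OF Suc.prems(1) Suc.prems(2) this]
  have "polar_deriv (Suc d) \<zeta> f \<noteq> 0"
  proof
    assume "polar_deriv (Suc d) \<zeta> f = 0"
    then have "cmod \<zeta> < \<rho>" by (intro L(2)) auto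
    with \<open>cmod \<zeta> \<ge> \<rho>\<close> show False by simp
  qed
  moreover have "cmod z \<ge> \<rho>" if "poly g1 z = 0" for z
    using that Suc.prems(4)[of z] by (simp add: g1)
  ultimately have "apolar d (polar_deriv (Suc d) \<zeta> f) g1 \<noteq> 0"
    using L dg1 \<open>g1 \<noteq> 0\<close> by (intro Suc.IH) auto
  then show ?case
    using apolar_mult_linear[of g1 d f \<zeta>] dg1 by (auto simp: g1)
qed

section \<open>Zeros of the truncated exponential\<close>

lemma power_div_fact_le_exp:
  fixes x :: real assumes "x \<ge> 0" shows "x ^ n / fact n \<le> exp x"
proof -
  have s: "(\<lambda>k. x ^ k / fact k) sums exp x"
    using exp_converges[of x] by (simp add: divide_inverse mult.commute)
  have "(\<Sum>k\<in>{n}. x ^ k / fact k) \<le> exp x"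
    unfolding sums_unique[OF s] by (rule sum_le_suminf[OF sums_summable[OF s]]) (use assms in auto)
  then show ?thesis by simp
qed

text \<open>At a zero the exponential series equals its tail after degree \<open>n\<close>. If \<open>|z| < \<alpha>n\<close>, the tail is
  dominated by a geometric series of ratio \<open>\<alpha>\<close> with first term at most \<open>\<alpha>(\<alpha>n)^n / n!\<close>, where
  \<open>(\<alpha>n)^n / n! \<le> (\<alpha>e)^n = exp (-\<alpha>n)\<close> by the choice of \<open>\<alpha>\<close>. As \<open>\<alpha> < 1/2\<close>, the tail is
  smaller than \<open>exp (-\<alpha>n)\<close>, which is a lower bound for \<open>|exp z|\<close>.\<close>

lemma truncated_exp_root_bound:
  fixes \<alpha> :: real and z :: complex
  assumes \<alpha>: "\<alpha> * exp (1 + \<alpha>) = 1" and n: "n > 0"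
    and root: "(\<Sum>k\<le>n. z ^ k / fact k) = 0"
  shows "cmod z \<ge> \<alpha> * real n"
proof (rule ccontr)
  define r where "r = cmod z"
  assume "\<not> cmod z \<ge> \<alpha> * real n"
  then have r: "0 \<le> r" "r < \<alpha> * real n" by (auto simp: r_def)
  have pos: "\<alpha> > 0" using \<alpha> zero_less_mult_pos2[of \<alpha> "exp (1 + \<alpha>)"] by simp
  have half: "\<alpha> < 1 / 2"
  proof (rule ccontr)
    assume "\<not> \<alpha> < 1 / 2"
    then have "1 / 2 * (1 + (1 + \<alpha>)) \<le> \<alpha> * exp (1 + \<alpha>)"
      by (intro mult_mono exp_ge_add_one_self) auto
    with \<alpha> \<open>\<not> \<alpha> < 1 / 2\<close> show False by simp
  qed
  define E where "E = exp (- (\<alpha> * real n))"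
  define q where "q = r ^ n / fact n"
  have "(\<alpha> * real n) ^ n / fact n \<le> \<alpha> ^ n * exp (real n)"
    using power_div_fact_le_exp[of "real n" n] pos
    by (simp add: power_mult_distrib mult_left_mono flip: times_divide_eq_right)
  also have "\<dots> = (\<alpha> * exp 1) ^ n"
    by (simp add: power_mult_distrib exp_of_nat_mult[symmetric])
  also have "\<alpha> * exp 1 = exp (- \<alpha>)"
    using \<alpha> by (simp add: exp_add exp_minus field_simps)
  also have "exp (- \<alpha>) ^ n = E"
    by (simp add: E_def exp_of_nat_mult[symmetric] mult.commute)
  finally have qE: "q \<le> E"
    unfolding q_def using r by (meson divide_right_mono fact_ge_zero less_imp_le order_trans power_mono)
  have s: "(\<lambda>k. z ^ k / fact k) sums exp z"
    using exp_converges[of z] by (simp add: scaleR_conv_of_real divide_inverse mult.commute)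
  have tail: "(\<lambda>k. z ^ (k + Suc n) / fact (k + Suc n)) sums exp z"
    using sums_split_initial_segment[OF s, of "Suc n"] root by (simp add: lessThan_Suc_atMost)
  have geo: "(\<lambda>k. E * \<alpha> * \<alpha> ^ k) sums (E * \<alpha> * (1 / (1 - \<alpha>)))"
    using pos half by (intro sums_mult geometric_sums) auto
  have le: "cmod (z ^ (k + Suc n) / fact (k + Suc n)) \<le> E * \<alpha> * \<alpha> ^ k" for k
  proof -
    have "fact n * real n ^ m \<le> fact (m + n)" for m
    proof (induction m)
      case (Suc m)
      have "fact n * real n ^ Suc m = real n * (fact n * real n ^ m)" by simp
      also have "\<dots> \<le> real (Suc (m + n)) * fact (m + n)"
        by (intro mult_mono Suc.IH) auto
      finally show ?case by simp
    qed simp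
    note F = this[of "Suc k"]
    have "cmod (z ^ (k + Suc n) / fact (k + Suc n)) = r ^ (k + Suc n) / fact (k + Suc n)"
      by (simp add: norm_divide norm_power r_def norm_mult del: fact_Suc)
    also have "\<dots> \<le> r ^ (k + Suc n) / (fact n * real n ^ Suc k)"
      using F n r by (intro divide_left_mono) (auto simp del: fact_Suc)
    also have "\<dots> = q * (r / real n) ^ Suc k"
      by (simp add: q_def power_add power_divide)
    also have "\<dots> \<le> E * \<alpha> ^ Suc k"
      using qE r n by (intro mult_mono power_mono) (auto simp: E_def q_def field_simps)
    finally show ?thesis by (simp add: mult.assoc)
  qed
  have "cmod (exp z) \<le> E * \<alpha> * (1 / (1 - \<alpha>))"
    by (rule norm_sums_le[OF tail geo le])
  also have "\<dots> < E"
    using half pos by (simp add: E_def field_simps)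
  also have "E \<le> exp (Re z)"
    using r abs_Re_le_cmod[of z] by (simp add: E_def r_def)
  finally show False by simp
qed

section \<open>The matching polynomial and the permanent\<close>

definition matching_poly :: "('a \<times> 'b \<Rightarrow> complex) \<Rightarrow> 'a set \<Rightarrow> 'b set \<Rightarrow> complex poly" where
  "matching_poly x R C = (\<Sum>M\<in>matchings R C. Polynomial.monom (\<Prod>e\<in>M. x e) (card R - card M))"

lemma card_matching_le: "finite R \<Longrightarrow> M \<in> matchings R C \<Longrightarrow> card M \<le> card R"
  by (rule card_inj_on_le[of fst]) (auto simp: matchings_def)

lemma degree_matching_poly:
  assumes fin: "finite R" "finite C"
  shows "degree (matching_poly x R C) = card R" and "matching_poly x R C \<noteq> 0"
proof -
  have empty: "(if card R - card M = card R then \<Prod>e\<in>M. x e else 0) = (if M = {} then 1 else 0)"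
    if "M \<in> matchings R C" for M
  proof -
    have "card R - card M = card R \<longleftrightarrow> card M = 0"
      using card_matching_le[OF fin(1) that] by auto
    then show ?thesis
      using finite_matching[OF fin that] by simp
  qed
  have "poly.coeff (matching_poly x R C) (card R) =
      (\<Sum>M\<in>matchings R C. if M = {} then 1 else 0)"
    unfolding matching_poly_def coeff_sum coeff_monom by (rule sum.cong[OF refl empty])
  also have "\<dots> = 1"
    using fin by (subst sum.delta) (auto simp: finite_matchings, simp add: matchings_def)
  finally have top: "poly.coeff (matching_poly x R C) (card R) = 1" .
  show "degree (matching_poly x R C) = card R"
  proof (rule antisym)
    show "degree (matching_poly x R C) \<le> card R"
      unfolding matching_poly_def
      by (rule degree_sum_le[OF finite_matchings[OF fin]]) (meson degree_monom_le diff_le_self order.trans)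
    show "card R \<le> degree (matching_poly x R C)"
      by (rule le_degree) (simp add: top)
  qed
  show "matching_poly x R C \<noteq> 0" using top by auto
qed

lemma poly_matching_poly:
  assumes fin: "finite R" "finite C" and "t \<noteq> 0"
  shows "poly (matching_poly x R C) t = t ^ card R * matching_sum (\<lambda>e. x e / t) R C"
proof -
  have "(\<Prod>e\<in>M. x e) * t ^ (card R - card M) = t ^ card R * (\<Prod>e\<in>M. x e / t)"
    if "M \<in> matchings R C" for M
    using card_matching_le[OF fin(1) that] \<open>t \<noteq> 0\<close> by (simp add: prod_dividef power_diff)
  then show ?thesis
    by (simp add: matching_poly_def matching_sum_def poly_sum poly_monom sum_distrib_left)
qed

text \<open>At \<open>t \<noteq> 0\<close> the matching polynomial is \<open>t^|R|\<close> times the matching sum of the weights \<open>x / t\<close>, which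
  satisfy the bound \<open>1/4\<close> as soon as \<open>|t| \<ge> B\<close>.\<close>

lemma matching_poly_root_bound:
  assumes fin: "finite R" "finite C" and "B > 0"
    and row: "\<And>i. i \<in> R \<Longrightarrow> (\<Sum>j\<in>C. cmod (x (i, j))) \<le> B / 4"
    and col: "\<And>j. j \<in> C \<Longrightarrow> (\<Sum>i\<in>R. cmod (x (i, j))) \<le> B / 4"
    and root: "poly (matching_poly x R C) t = 0"
  shows "cmod t < B"
proof (rule ccontr)
  assume "\<not> cmod t < B"
  then have t: "cmod t \<ge> B" "t \<noteq> 0" using \<open>B > 0\<close> by auto
  have scale: "s / cmod t \<le> 1 / 4" if "s \<le> B / 4" for s
    using that t by (simp add: divide_le_eq)
  have "matching_sum (\<lambda>e. x e / t) R C \<noteq> 0"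
  proof (rule matching_sum_nonzero[OF fin])
    show "(\<Sum>j\<in>C. cmod (x (i, j) / t)) \<le> 1 / 4" if "i \<in> R" for i
      using scale[OF row[OF that]] by (simp add: norm_divide sum_divide_distrib)
    show "(\<Sum>i\<in>R. cmod (x (i, j) / t)) \<le> 1 / 4" if "j \<in> C" for j
      using scale[OF col[OF that]] by (simp add: norm_divide sum_divide_distrib)
  qed
  with root t(2) show False
    by (simp add: poly_matching_poly[OF fin])
qed

lemma sum_permutes_prod_eq_fact_coeff:
  fixes a :: "'a \<times> 'a \<Rightarrow> complex"
  assumes S: "finite S"
  shows "(\<Sum>\<sigma> | \<sigma> permutes S. \<Prod>i\<in>S. 1 + a (i, \<sigma> i)) =
    (\<Sum>k\<le>card S. fact k * poly.coeff (matching_poly a S S) k)"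
proof -
  have "(\<Sum>k\<le>card S. fact k * poly.coeff (matching_poly a S S) k) =
      (\<Sum>M\<in>matchings S S. \<Sum>k\<le>card S. if card S - card M = k then fact k * (\<Prod>e\<in>M. a e) else 0)"
    unfolding matching_poly_def coeff_sum coeff_monom sum_distrib_left
    by (subst sum.swap) (intro sum.cong refl, simp)
  also have "\<dots> = (\<Sum>M\<in>matchings S S. fact (card S - card M) * (\<Prod>e\<in>M. a e))"
    by (intro sum.cong refl) simp
  finally show ?thesis
    by (simp add: sum_permutes_prod_one_plus[OF S])
qed

text \<open>The Taylor polynomial of \<open>exp (- z)\<close>. The sign of the argument cancels the alternating signs of the
  apolar pairing.\<close>

definition truncated_exp_neg :: "nat \<Rightarrow> complex poly" where
  "truncated_exp_neg n = (\<Sum>k\<le>n. Polynomial.monom ((- 1) ^ k / fact k) k)"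

lemma coeff_truncated_exp_neg:
  "poly.coeff (truncated_exp_neg n) k = (if k \<le> n then (- 1) ^ k / fact k else 0)"
  by (simp add: truncated_exp_neg_def coeff_sum)

lemma poly_truncated_exp_neg: "poly (truncated_exp_neg n) z = (\<Sum>k\<le>n. (- z) ^ k / fact k)"
  by (simp add: truncated_exp_neg_def poly_sum poly_monom power_minus[of z])

lemma degree_truncated_exp_neg: "degree (truncated_exp_neg n) = n"
  by (intro antisym degree_le le_degree) (simp_all add: coeff_truncated_exp_neg)

lemma apolar_truncated_exp_neg:
  "(- 1) ^ n * fact n * apolar n f (truncated_exp_neg n) = (\<Sum>k\<le>n. fact k * poly.coeff f k)"
  unfolding apolar_def sum_distrib_left
proof (intro sum.cong refl)
  fix k assume "k \<in> {..n}"
  then have k: "k \<le> n" by simp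
  have "(- 1 :: complex) ^ n * (- 1) ^ k * (- 1) ^ (n - k) = (- 1) ^ (2 * n)"
    using k by (simp flip: power_add)
  then have sgn: "(- 1 :: complex) ^ n * (- 1) ^ k * (- 1) ^ (n - k) = 1" by simp
  have "(- 1) ^ n * fact n * ((- 1) ^ k * poly.coeff f k * poly.coeff (truncated_exp_neg n) (n - k) /
      of_nat (n choose k)) =
      ((- 1) ^ n * (- 1) ^ k * (- 1) ^ (n - k)) * (fact n / (fact (n - k) * of_nat (n choose k))) * poly.coeff f k"
    by (simp add: coeff_truncated_exp_neg)
  also have "fact n / (fact (n - k) * of_nat (n choose k)) = (fact k :: complex)"
    using binomial_fact[OF k, where 'a = complex] by simp
  finally show "(- 1) ^ n * fact n * ((- 1) ^ k * poly.coeff f k *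
      poly.coeff (truncated_exp_neg n) (n - k) / of_nat (n choose k)) = fact k * poly.coeff f k"
    by (simp add: sgn)
qed

theorem theorem1p6:
  fixes \<alpha> :: real and n :: nat and Z :: "complex mat"
  assumes "\<alpha> * exp (1 + \<alpha>) = 1"
    and "n > 0"
    and "Z \<in> carrier_mat n n"
    and "\<And>i. i < n \<Longrightarrow> (\<Sum>j = 0..<n. cmod (1 - Z $$ (i, j))) \<le> \<alpha> * real n / 4"
    and "\<And>j. j < n \<Longrightarrow> (\<Sum>i = 0..<n. cmod (1 - Z $$ (i, j))) \<le> \<alpha> * real n / 4"
  shows "permanent Z \<noteq> 0"
proof -
  define a where "a e = Z $$ e - 1" for e
  define f where "f = matching_poly a {0..<n} {0..<n}"
  have "\<alpha> > 0"
    using assms(1) zero_less_mult_pos2[of \<alpha> "exp (1 + \<alpha>)"] by simp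
  then have \<rho>: "\<alpha> * real n > 0" using assms(2) by simp
  have "apolar n f (truncated_exp_neg n) \<noteq> 0"
  proof (rule grace_disc[where \<rho> = "\<alpha> * real n"])
    show "degree f = n" "f \<noteq> 0"
      unfolding f_def by (simp_all add: degree_matching_poly)
    show "cmod t < \<alpha> * real n" if "poly f t = 0" for t
    proof (rule matching_poly_root_bound[OF _ _ \<rho> _ _ that[unfolded f_def]])
      show "(\<Sum>j\<in>{0..<n}. cmod (a (i, j))) \<le> \<alpha> * real n / 4" if "i \<in> {0..<n}" for i
        using assms(4)[of i] that by (simp add: a_def norm_minus_commute)
      show "(\<Sum>i\<in>{0..<n}. cmod (a (i, j))) \<le> \<alpha> * real n / 4" if "j \<in> {0..<n}" for j
        using assms(5)[of j] that by (simp add: a_def norm_minus_commute)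
    qed simp_all
    show "degree (truncated_exp_neg n) = n" by (rule degree_truncated_exp_neg)
    show "cmod z \<ge> \<alpha> * real n" if "poly (truncated_exp_neg n) z = 0" for z
      using truncated_exp_root_bound[OF assms(1,2), of "- z"] that by (simp add: poly_truncated_exp_neg)
    have "poly.coeff (truncated_exp_neg n) 0 \<noteq> 0" by (simp add: coeff_truncated_exp_neg)
    then show "truncated_exp_neg n \<noteq> 0" by auto
  qed
  then have "(\<Sum>k\<le>n. fact k * poly.coeff f k) \<noteq> 0"
    by (simp flip: apolar_truncated_exp_neg)
  moreover have "permanent Z = (\<Sum>k\<le>n. fact k * poly.coeff f k)"
    using sum_permutes_prod_eq_fact_coeff[of "{0..<n}" a] assms(3)
    by (simp add: permanent_def a_def f_def)
  ultimately show ?thesis by simp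
qed

end
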